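(* Let $n\ge 2$ be an integer, $\lambda>\frac{1}{n-1}$ and $\mu>0$. Then there exists a unique solution $r\in C^2([0,\infty))$ of the problem $$\left\{\begin{aligned}&\frac{r''(y)}{1+r'(y)^2}=\frac{n-1}{r(y)}-\frac{1+r'(y)^2}{\lambda(r(y)-yr'(y))},\quad r(y)>0,\quad\forall y>0,\\ &r(0)=\mu,\quad r'(0)=0,\end{aligned}\right.$$ which satisfies $$r(y)>yr'(y)\quad\forall y>0$$ and $$r''(0)=\left(n-1-\frac{1}{\lambda}\right)\frac{1}{\mu}.$$
   Context: Here $r'$ and $r''$ denote the first and second derivatives with respect to $y$ (one-sided at $y=0$). Being a solution of the equation includes that the denominator $r(y)-yr'(y)$ does not vanish. *)

theory Defs
  imports "HOL-Analysis.Analysis"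
begin

text \<open>
  Functions on \<open>[0,\<infinity>)\<close> are represented by total functions on the reals of which only the
  values on \<open>{0..}\<close> matter. Differentiation relative to \<open>{0..}\<close> is the ordinary derivative at
  \<open>y > 0\<close> and the right-hand derivative at \<open>y = 0\<close>.
\<close>

definition half_deriv :: "(real \<Rightarrow> real) \<Rightarrow> real \<Rightarrow> real" where
  "half_deriv f y = vector_derivative f (at y within {0..})"

definition C2_half_line :: "(real \<Rightarrow> real) \<Rightarrow> bool" where
  "C2_half_line f \<longleftrightarrow>
     f differentiable_on {0..} \<and>
     half_deriv f differentiable_on {0..} \<and>
     continuous_on {0..} (half_deriv (half_deriv f))"

text \<open>
  The denominator condition is explicit because division by zero is total in HOL.
\<close>

definition is_solution :: "nat \<Rightarrow> real \<Rightarrow> real \<Rightarrow> (real \<Rightarrow> real) \<Rightarrow> bool" where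
  "is_solution n lam \<mu> r \<longleftrightarrow>
     C2_half_line r \<and>
     (\<forall>y>0. r y - y * half_deriv r y \<noteq> 0 \<and>
        half_deriv (half_deriv r) y / (1 + (half_deriv r y)\<^sup>2) =
          (real n - 1) / r y
          - (1 + (half_deriv r y)\<^sup>2) / (lam * (r y - y * half_deriv r y)) \<and>
        r y > 0) \<and>
     r 0 = \<mu> \<and>
     half_deriv r 0 = 0"

end

theory Submission
  imports Defs
begin

text \<open>
  Write \<open>p = r'\<close> and \<open>w = r - y p\<close>. The equation is regular as long as \<open>r\<close> and \<open>w\<close> are
  positive, so everything rests on a priori bounds. Because \<open>lam (n - 1) > 1\<close>, the slope \<open>p\<close> can
  only cross zero upwards, so \<open>p \<ge> 0\<close> and \<open>r \<ge> \<mu>\<close>. Where \<open>p' \<ge> 0\<close> the equation itself gives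
  \<open>(1 + p\<^sup>2) r \<le> lam (n - 1) w \<le> lam (n - 1) r\<close>, hence \<open>1 + p\<^sup>2 \<le> lam (n - 1)\<close> and
  \<open>w \<ge> \<mu> / (lam (n - 1))\<close>; where \<open>p' < 0\<close>, \<open>p\<close> decreases and \<open>w\<close> increases because
  \<open>w' = - y p'\<close>, so the bounds persist. Truncating the right-hand side outside these bounds makes it
  globally Lipschitz at each \<open>y\<close>, without changing the solutions.
\<close>

section \<open>Ordinary differential equations on the half line\<close>

text \<open>A nontrivial filter makes vector derivatives relative to \<open>{0..}\<close> unique,
  also at the endpoint 0; this is what later identifies \<open>half_deriv\<close>.\<close>

lemma half_line_not_bot: "(t::real) \<ge> 0 \<Longrightarrow> at t within {0..} \<noteq> bot"
  using islimpt_Icc[of 0 "t + 1" t] islimpt_subset[of t "{0..t+1}" "{0..}"]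
  by (auto simp: trivial_limit_within)

lemma integral_has_vector_derivative_half_line:
  fixes g :: "real \<Rightarrow> 'a::banach"
  assumes "continuous_on {0..} g" "t \<ge> 0"
  shows "((\<lambda>u. integral {0..u} g) has_vector_derivative g t) (at t within {0..})"
proof -
  have "((\<lambda>u. integral {0..u} g) has_vector_derivative g t) (at t within {0..t+1})"
    using assms by (intro integral_has_vector_derivative) (auto intro: continuous_on_subset)
  \<comment> \<open>The compact interval ends beyond \<open>t\<close>, so near \<open>t\<close> it
    agrees with the half line and yields the same filter, also when \<open>t = 0\<close>.\<close>
  moreover have "at t within {0..} = at t within {0..t+1}"
    by (rule at_within_nhd[of _ "{..<t+1}"]) auto
  ultimately show ?thesis by simp
qed

lemma half_line_nonincreasing:
  fixes f :: "real \<Rightarrow> real"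
  assumes "a \<le> b"
    and "\<And>x. x \<in> {a..b} \<Longrightarrow> (f has_real_derivative f' x) (at x within {a..b})"
    and "\<And>x. x \<in> {a<..<b} \<Longrightarrow> f' x \<le> 0"
  shows "f b \<le> f a"
proof (cases "a = b")
  case False
  with assms(1) have "a < b" by simp
  then have "\<exists>x\<in>{a<..<b}. f b - f a = (*) (f' x) (b - a)"
    using assms(2) by (intro mvt_simple) (auto simp: has_field_derivative_def)
  then show ?thesis
    using assms(3) \<open>a < b\<close> by (metis diff_gt_0_iff_gt diff_le_0_iff_le less_eq_real_def mult_nonpos_nonneg)
qed simp

text \<open>Integrating factor: with \<open>L\<close> a primitive of \<open>l\<close>, the function
  \<open>exp (- L) * D\<close> has derivative \<open>exp (- L) * (D' - l * D) \<le> 0\<close> and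
  starts at 0.\<close>

lemma gronwall_half_line:
  fixes D :: "real \<Rightarrow> real"
  assumes l: "continuous_on {0..} l"
    and D: "\<And>u. u \<ge> 0 \<Longrightarrow> (D has_real_derivative D' u) (at u within {0..})"
    and le: "\<And>u. u \<ge> 0 \<Longrightarrow> D' u \<le> l u * D u"
    and init: "D 0 = 0" and t: "t \<ge> 0"
  shows "D t \<le> 0"
proof -
  define L where "L u = integral {0..u} l" for u
  define E where "E u = exp (- L u) * D u" for u
  have L: "(L has_real_derivative l u) (at u within {0..})" if "u \<ge> 0" for u
    using integral_has_vector_derivative_half_line[OF l that]
    unfolding L_def has_real_derivative_iff_has_vector_derivative by simp
  have E: "(E has_real_derivative exp (- L u) * (D' u - l u * D u)) (at u within {0..})"
    if "u \<ge> 0" for u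
    unfolding E_def
    by (rule derivative_eq_intros L[OF that] D[OF that] refl)+ (simp add: algebra_simps)
  have "E t \<le> E 0"
  proof (rule half_line_nonincreasing[OF t])
    show "(E has_real_derivative exp (- L u) * (D' u - l u * D u)) (at u within {0..t})"
      if "u \<in> {0..t}" for u
      by (rule DERIV_subset[OF E]) (use that in auto)
    show "exp (- L u) * (D' u - l u * D u) \<le> 0" if "u \<in> {0<..<t}" for u
      using le[of u] that by (intro mult_nonneg_nonpos) auto
  qed
  then show ?thesis
    by (simp add: E_def init mult_le_0_iff)
qed

section \<open>Uniqueness and global existence for Lipschitz fields\<close>

lemma has_real_derivative_inner_self:
  fixes Z :: "real \<Rightarrow> 'a::real_inner"
  assumes "(Z has_vector_derivative z) (at u within S)"
  shows "((\<lambda>u. Z u \<bullet> Z u) has_real_derivative 2 * (Z u \<bullet> z)) (at u within S)"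
proof -
  have "((\<lambda>u. Z u \<bullet> Z u) has_derivative (\<lambda>h. Z u \<bullet> (h *\<^sub>R z) + (h *\<^sub>R z) \<bullet> Z u)) (at u within S)"
    using assms unfolding has_vector_derivative_def by (intro has_derivative_inner)
  moreover have "(\<lambda>h. Z u \<bullet> (h *\<^sub>R z) + (h *\<^sub>R z) \<bullet> Z u) = (*) (2 * (Z u \<bullet> z))"
    by (rule ext) (simp add: inner_commute)
  ultimately show ?thesis
    unfolding has_field_derivative_def by (rule has_derivative_eq_rhs)
qed

text \<open>Gronwall applied to the squared distance of two solutions, which is differentiable even
  where they meet. By Cauchy-Schwarz its derivative is at most \<open>2 * l\<close> times
  itself.\<close>

lemma ode_unique_half_line:
  fixes f :: "real \<Rightarrow> 'a::real_inner \<Rightarrow> 'a"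
  assumes l: "continuous_on {0..} l"
    and lip: "\<And>t x y. t \<ge> 0 \<Longrightarrow> norm (f t x - f t y) \<le> l t * norm (x - y)"
    and X: "\<And>t. t \<ge> 0 \<Longrightarrow> (X has_vector_derivative f t (X t)) (at t within {0..})"
    and Y: "\<And>t. t \<ge> 0 \<Longrightarrow> (Y has_vector_derivative f t (Y t)) (at t within {0..})"
    and init: "X 0 = Y 0" and t: "t \<ge> 0"
  shows "X t = Y t"
proof -
  define Z where "Z u = X u - Y u" for u
  have "Z t \<bullet> Z t \<le> 0"
  proof (rule gronwall_half_line[where D = "\<lambda>u. Z u \<bullet> Z u" and l = "\<lambda>u. 2 * l u"])
    show "continuous_on {0..} (\<lambda>u. 2 * l u)"
      by (intro continuous_intros l)
    show "((\<lambda>u. Z u \<bullet> Z u) has_real_derivative 2 * (Z u \<bullet> (f u (X u) - f u (Y u)))) (at u within {0..})"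
      if "u \<ge> 0" for u
      unfolding Z_def
      by (rule has_real_derivative_inner_self has_vector_derivative_diff X Y that)+
    show "2 * (Z u \<bullet> (f u (X u) - f u (Y u))) \<le> 2 * l u * (Z u \<bullet> Z u)" if "u \<ge> 0" for u
    proof -
      have "Z u \<bullet> (f u (X u) - f u (Y u)) \<le> norm (Z u) * norm (f u (X u) - f u (Y u))"
        by (rule norm_cauchy_schwarz)
      also have "\<dots> \<le> norm (Z u) * (l u * norm (Z u))"
        unfolding Z_def using that by (intro mult_left_mono lip) auto
      also have "\<dots> = l u * (Z u \<bullet> Z u)"
        by (simp add: power2_norm_eq_inner[symmetric] power2_eq_square)
      finally show ?thesis by simp
    qed
  qed (use init t in \<open>simp_all add: Z_def\<close>)
  then have "Z t = 0"
    by (metis inner_eq_zero_iff inner_ge_zero order_antisym)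
  then show ?thesis by (simp add: Z_def)
qed

text \<open>The Picard operator is a contraction with factor \<open>1/2\<close> for the norm weighted by
  \<open>exp (- 2 * K t)\<close>, where \<open>K\<close> is a primitive of the Lipschitz constant. The summand
  \<open>norm (f t 0)\<close> in \<open>k\<close> only serves to keep the weighted iterates bounded.\<close>

lemma ode_exists_half_line:
  fixes f :: "real \<Rightarrow> 'a::banach \<Rightarrow> 'a"
  assumes f: "continuous_on ({0..} \<times> UNIV) (\<lambda>(t, x). f t x)"
    and l: "continuous_on {0..} l"
    and lip: "\<And>t x y. t \<ge> 0 \<Longrightarrow> norm (f t x - f t y) \<le> l t * norm (x - y)"
  obtains X where "X 0 = x0"
    and "\<And>t. t \<ge> 0 \<Longrightarrow> (X has_vector_derivative f t (X t)) (at t within {0..})"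
proof -
  have f_comp: "continuous_on {0..} (\<lambda>t. f t (h t))" if "continuous_on {0..} h" for h
    using continuous_on_compose2[OF f continuous_on_Pair[OF continuous_on_id that]] by auto
  define k where "k t = \<bar>l t\<bar> + norm (f t 0)" for t
  define K where "K t = integral {0..t} k" for t
  have k: "continuous_on {0..} k"
    unfolding k_def by (intro continuous_intros l f_comp)
  have k_nonneg: "k t \<ge> 0" for t by (simp add: k_def)
  have K: "(K has_real_derivative k t) (at t within {0..})" if "t \<ge> 0" for t
    using integral_has_vector_derivative_half_line[OF k that]
    unfolding K_def has_real_derivative_iff_has_vector_derivative by simp
  have K0: "K 0 = 0" by (simp add: K_def)
  have K_cont: "continuous_on {0..} K"
    using K by (meson DERIV_continuous atLeast_iff continuous_on_eq_continuous_within)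
  \<comment> \<open>A function that is not integrable has integral 0 by convention, so the sign
    follows for every real \<open>t\<close> without a case split on it.\<close>
  have K_nonneg: "K t \<ge> 0" for t
    unfolding K_def using k_nonneg integral_nonneg not_integrable_integral by (metis order_refl)
  \<comment> \<open>The integrand is half the derivative of \<open>exp (2 * K u)\<close>; the
    contraction factor \<open>1/2\<close> originates here.\<close>
  have int_k: "((\<lambda>u. k u * exp (2 * K u)) has_integral (exp (2 * K t) - 1) / 2) {0..t}" if "t \<ge> 0" for t
  proof -
    have "((\<lambda>u. k u * exp (2 * K u)) has_integral (exp (2 * K t) / 2 - exp (2 * K 0) / 2)) {0..t}"
    proof (rule fundamental_theorem_of_calculus[OF that])
      fix u assume "u \<in> {0..t}"
      then have "((\<lambda>u. exp (2 * K u) / 2) has_real_derivative k u * exp (2 * K u)) (at u within {0..})"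
        by (auto intro!: derivative_eq_intros K)
      then show "((\<lambda>u. exp (2 * K u) / 2) has_vector_derivative k u * exp (2 * K u)) (at u within {0..t})"
        unfolding has_real_derivative_iff_has_vector_derivative[symmetric]
        by (rule DERIV_subset) auto
    qed
    then show ?thesis by (simp add: K0 diff_divide_distrib)
  qed
  \<comment> \<open>The unknown \<open>g\<close> stands for the rescaled solution
    \<open>exp (- 2 * K) X\<close>, so that the complete sup metric on bounded continuous functions
    plays the part of the weighted norm. Since these functions live on all reals,
    \<open>max 0 t\<close> extends the operator constantly to negative times.\<close>
  define G where "G g u = f u (exp (2 * K u) *\<^sub>R apply_bcontfun g u)" for g :: "real \<Rightarrow>\<^sub>C 'a" and u
  define P where "P g t = x0 + integral {0..t} (G g)" for g t
  define \<Phi> where "\<Phi> g t = exp (- 2 * K (max 0 t)) *\<^sub>R P g (max 0 t)" for g t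
  have G_cont: "continuous_on {0..} (G g)" for g
    unfolding G_def by (intro f_comp continuous_intros K_cont continuous_on_apply_bcontfun)
  have G_int: "G g integrable_on {0..t}" for g t
    by (rule integrable_continuous_real) (rule continuous_on_subset[OF G_cont], auto)
  have P_deriv: "(P g has_vector_derivative G g t) (at t within {0..})" if "t \<ge> 0" for g t
    unfolding P_def
    using has_vector_derivative_add[OF has_vector_derivative_const
        integral_has_vector_derivative_half_line[OF G_cont that]] by simp
  have P_cont: "continuous_on {0..} (P g)" for g
    using P_deriv by (meson atLeast_iff continuous_on_eq_continuous_within has_vector_derivative_continuous)
  \<comment> \<open>Used twice: with \<open>c = 1 + B\<close> to see that the iterates stay bounded,
    and with \<open>c = dist g h\<close> for the contraction.\<close>
  have weighted: "norm (exp (- 2 * K t) *\<^sub>R integral {0..t} h) \<le> c / 2"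
    if t: "t \<ge> 0" and c: "c \<ge> 0" and h: "h integrable_on {0..t}"
      and le: "\<And>u. u \<in> {0..t} \<Longrightarrow> norm (h u) \<le> c * (k u * exp (2 * K u))"
    for t c and h :: "real \<Rightarrow> 'a"
  proof -
    have i: "((\<lambda>u. c * (k u * exp (2 * K u))) has_integral c * ((exp (2 * K t) - 1) / 2)) {0..t}"
      by (rule has_integral_mult_right[OF int_k[OF t]])
    have "norm (integral {0..t} h) \<le> integral {0..t} (\<lambda>u. c * (k u * exp (2 * K u)))"
      by (rule integral_norm_bound_integral[OF h _ le]) (use i in auto)
    also have "\<dots> = c * ((exp (2 * K t) - 1) / 2)"
      using i by (rule integral_unique)
    also have "\<dots> \<le> c / 2 * exp (2 * K t)"
      using c by (simp add: algebra_simps)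
    finally have "exp (- 2 * K t) * norm (integral {0..t} h) \<le> exp (- 2 * K t) * (c / 2 * exp (2 * K t))"
      by (intro mult_left_mono) auto
    also have "\<dots> = c / 2"
      by (simp add: exp_minus field_simps)
    finally show ?thesis by simp
  qed
  have lip_k: "norm (f u x - f u y) \<le> k u * norm (x - y)" if "u \<ge> 0" for u x y
    by (rule order_trans[OF lip[OF that]]) (auto simp: k_def intro!: mult_right_mono add_increasing2)
  have \<Phi>_bcont: "\<Phi> g \<in> bcontfun" for g
  proof -
    have "continuous_on UNIV (\<lambda>t. exp (- 2 * K (max 0 t)) *\<^sub>R P g (max 0 t))"
      by (intro continuous_intros continuous_on_compose2[OF K_cont]
          continuous_on_compose2[OF P_cont]) auto
    moreover obtain B where B: "norm (apply_bcontfun g u) \<le> B" for u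
      using bounded_apply_bcontfun[of g] unfolding bounded_iff by auto
    have B0: "B \<ge> 0" using B[of 0] norm_ge_zero order_trans by blast
    have "norm (\<Phi> g t) \<le> norm x0 + (1 + B) / 2" for t
    proof -
      define s where "s = max 0 t"
      have s: "s \<ge> 0" by (simp add: s_def)
      have "norm (G g u) \<le> (1 + B) * (k u * exp (2 * K u))" if "u \<in> {0..s}" for u
      proof -
        let ?x = "exp (2 * K u) *\<^sub>R apply_bcontfun g u"
        have "norm (G g u) \<le> norm (f u ?x - f u 0) + norm (f u 0)"
          unfolding G_def using norm_triangle_sub by (metis add.commute)
        also have "\<dots> \<le> \<bar>l u\<bar> * norm ?x + norm (f u 0)"
          using that by (intro add_right_mono order_trans[OF lip]) (auto intro!: mult_right_mono)
        also have "\<dots> \<le> k u * (exp (2 * K u) * B) + k u * exp (2 * K u)"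
        proof (rule add_mono)
          show "\<bar>l u\<bar> * norm ?x \<le> k u * (exp (2 * K u) * B)"
            using B[of u] by (intro mult_mono) (auto simp: k_def)
          have "norm (f u 0) * 1 \<le> k u * exp (2 * K u)"
            using K_nonneg[of u] by (intro mult_mono) (auto simp: k_def)
          then show "norm (f u 0) \<le> k u * exp (2 * K u)" by simp
        qed
        finally show ?thesis by (simp add: algebra_simps)
      qed
      then have "norm (exp (- 2 * K s) *\<^sub>R integral {0..s} (G g)) \<le> (1 + B) / 2"
        using B0 by (intro weighted s G_int) auto
      moreover have "norm (exp (- 2 * K s) *\<^sub>R x0) \<le> norm x0"
        using K_nonneg[of s] by (simp add: mult_left_le_one_le)
      ultimately show ?thesis
        unfolding \<Phi>_def P_def s_def[symmetric] scaleR_add_right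
        by (intro order_trans[OF norm_triangle_ineq add_mono])
    qed
    then have "bounded (range (\<Phi> g))"
      by (auto intro: boundedI)
    ultimately show ?thesis
      by (simp add: bcontfun_def \<Phi>_def[abs_def])
  qed
  have apply_\<Phi>: "apply_bcontfun (Bcontfun (\<Phi> g)) = \<Phi> g" for g
    by (rule Bcontfun_inverse[OF \<Phi>_bcont])
  have "dist (Bcontfun (\<Phi> g)) (Bcontfun (\<Phi> h)) \<le> 1 / 2 * dist g h" for g h
  proof (rule dist_bound)
    fix t :: real
    define s where "s = max 0 t"
    have s: "s \<ge> 0" by (simp add: s_def)
    have "norm (exp (- 2 * K s) *\<^sub>R integral {0..s} (\<lambda>u. G g u - G h u)) \<le> dist g h / 2"
    proof (rule weighted[OF s])
      show "(\<lambda>u. G g u - G h u) integrable_on {0..s}"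
        by (intro integrable_diff G_int)
      fix u assume u: "u \<in> {0..s}"
      have "norm (G g u - G h u) \<le> k u * norm (exp (2 * K u) *\<^sub>R apply_bcontfun g u - exp (2 * K u) *\<^sub>R apply_bcontfun h u)"
        unfolding G_def using u by (intro lip_k) auto
      also have "\<dots> = k u * (exp (2 * K u) * dist (apply_bcontfun g u) (apply_bcontfun h u))"
        by (simp add: dist_norm scaleR_diff_right[symmetric])
      also have "\<dots> \<le> k u * (exp (2 * K u) * dist g h)"
        by (intro mult_left_mono dist_bounded k_nonneg) auto
      finally show "norm (G g u - G h u) \<le> dist g h * (k u * exp (2 * K u))"
        by (simp add: mult_ac)
    qed simp
    moreover have "\<Phi> g t - \<Phi> h t = exp (- 2 * K s) *\<^sub>R integral {0..s} (\<lambda>u. G g u - G h u)"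
      unfolding \<Phi>_def P_def s_def[symmetric] Henstock_Kurzweil_Integration.integral_diff[OF G_int G_int]
      by (simp add: algebra_simps)
    ultimately show "dist (apply_bcontfun (Bcontfun (\<Phi> g)) t) (apply_bcontfun (Bcontfun (\<Phi> h)) t) \<le> 1 / 2 * dist g h"
      by (simp add: apply_\<Phi> dist_norm)
  qed
  then have "\<exists>!g. Bcontfun (\<Phi> g) = g"
    by (intro banach_fix_type[of "1/2"]) auto
  then obtain g where "Bcontfun (\<Phi> g) = g" by blast
  then have g: "apply_bcontfun g = \<Phi> g" by (metis apply_\<Phi>)
  \<comment> \<open>The fixed point equation says
    \<open>g t = exp (- 2 * K t) *\<^sub>R P g t\<close>, so the two exponential weights
    cancel.\<close>
  have G_eq: "G g t = f t (P g t)" if "t \<ge> 0" for t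
    using that unfolding G_def g \<Phi>_def by (simp add: exp_minus)
  show ?thesis
  proof
    show "P g 0 = x0" by (simp add: P_def)
    show "(P g has_vector_derivative f t (P g t)) (at t within {0..})" if "t \<ge> 0" for t
      using P_deriv[OF that, of g] by (simp add: G_eq that)
  qed
qed

section \<open>A priori bounds\<close>

text \<open>The equation solved for the second derivative, with \<open>N\<close> in the role of
  \<open>n - 1\<close> and the slope \<open>p\<close> as an independent variable.\<close>

definition expander_rhs :: "real \<Rightarrow> real \<Rightarrow> real \<Rightarrow> real \<Rightarrow> real \<Rightarrow> real" where
  "expander_rhs N lam y r p = (1 + p\<^sup>2) * (N / r - (1 + p\<^sup>2) / (lam * (r - y * p)))"

text \<open>First-order system for the radius and its slope, with positivity built in. The set
  \<open>S\<close> is a parameter so that the a priori bounds can be used on compact intervals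
  before a global solution is available.\<close>

definition solves_expander ::
    "real \<Rightarrow> real \<Rightarrow> real \<Rightarrow> (real \<Rightarrow> real) \<Rightarrow> (real \<Rightarrow> real) \<Rightarrow> real set \<Rightarrow> bool" where
  "solves_expander N lam \<mu> r p S \<longleftrightarrow> r 0 = \<mu> \<and> p 0 = 0 \<and>
     (\<forall>y\<in>S. (r has_real_derivative p y) (at y within S) \<and>
        (p has_real_derivative expander_rhs N lam y (r y) (p y)) (at y within S) \<and>
        r y > 0 \<and> r y - y * p y > 0)"

lemma solves_expander_subset:
  "solves_expander N lam \<mu> r p S \<Longrightarrow> T \<subseteq> S \<Longrightarrow> solves_expander N lam \<mu> r p T"
  unfolding solves_expander_def by (meson DERIV_subset subsetD)

text \<open>The point \<open>z\<close> is the maximum of the compact set where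
  \<open>f \<ge> 0\<close>. The intermediate value theorem puts a zero of \<open>f\<close> in
  \<open>{z..b}\<close>, and by maximality it can only be \<open>z\<close>.\<close>

lemma last_nonneg_before:
  fixes f :: "real \<Rightarrow> real"
  assumes f: "continuous_on {a..b} f" and "a \<le> b" "f a \<ge> 0" "f b < 0"
  obtains z where "a \<le> z" "z < b" "f z = 0" "\<And>x. z < x \<Longrightarrow> x \<le> b \<Longrightarrow> f x < 0"
proof -
  define S where "S = {x \<in> {a..b}. 0 \<le> f x}"
  have "closed S" unfolding S_def
    by (intro continuous_on_closed_Collect_le f continuous_intros)
  moreover have "S \<subseteq> {a..b}" by (auto simp: S_def)
  ultimately have "compact S"
    by (metis bounded_closed_interval bounded_subset compact_eq_bounded_closed)
  moreover have "a \<in> S" using assms by (auto simp: S_def)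
  ultimately obtain z where z: "z \<in> S" "\<And>x. x \<in> S \<Longrightarrow> x \<le> z"
    by (metis compact_attains_sup empty_iff)
  have neg: "f x < 0" if "z < x" "x \<le> b" for x
    using z(2)[of x] z(1) that by (force simp: S_def)
  have "z < b" using z(1) \<open>f b < 0\<close> by (cases "z = b") (auto simp: S_def)
  have "\<exists>x\<ge>z. x \<le> b \<and> f x = 0"
    using z(1) \<open>f b < 0\<close> \<open>z < b\<close>
    by (intro IVT2') (auto simp: S_def intro: continuous_on_subset[OF f])
  then have "f z = 0"
    using neg by (metis less_eq_real_def less_irrefl)
  then show ?thesis
    using that[of z] z(1) \<open>z < b\<close> neg by (auto simp: S_def)
qed

section \<open>Bounds along a solution on \<open>{0..b}\<close>, uniform in \<open>b\<close>\<close>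

context
  fixes N lam \<mu> b :: real and r p :: "real \<Rightarrow> real"
  assumes N: "N > 0" and lam: "lam > 0" and lamN: "lam * N > 1" and \<mu>: "\<mu> > 0"
    and sol: "solves_expander N lam \<mu> r p {0..b}"
begin

lemma
  assumes "y \<in> {0..b}"
  shows radius_deriv: "(r has_real_derivative p y) (at y within {0..b})"
    and slope_deriv: "(p has_real_derivative expander_rhs N lam y (r y) (p y)) (at y within {0..b})"
    and radius_pos: "r y > 0"
    and denominator_pos: "r y - y * p y > 0"
  using sol assms unfolding solves_expander_def by blast+

lemma initial_values: "r 0 = \<mu>" "p 0 = 0"
  using sol unfolding solves_expander_def by blast+

text \<open>If \<open>p\<close> were negative at \<open>y\<close>, it would be negative everywhere
  between its last zero and \<open>y\<close>. At that zero, however, \<open>p\<close> has positive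
  derivative.\<close>

lemma expander_slope_nonneg:
  assumes y: "y \<in> {0..b}"
  shows "p y \<ge> 0"
proof (rule ccontr)
  assume "\<not> p y \<ge> 0"
  then have neg: "p y < 0" by simp
  have "continuous_on {0..b} p"
    using slope_deriv by (meson DERIV_continuous continuous_on_eq_continuous_within)
  then have "continuous_on {0..y} p"
    by (rule continuous_on_subset) (use y in auto)
  then obtain z where z: "0 \<le> z" "z < y" "p z = 0" "\<And>x. z < x \<Longrightarrow> x \<le> y \<Longrightarrow> p x < 0"
    using last_nonneg_before[of 0 y p] y neg initial_values(2) by auto
  then have zb: "z \<in> {0..b}" using y by auto
  \<comment> \<open>Where \<open>p = 0\<close> the denominator is \<open>r\<close> itself, so the
    sign of the right-hand side reduces to \<open>lam * N > 1\<close>.\<close>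
  have "1 / (lam * r z) < N / r z"
    using radius_pos[OF zb] lam lamN by (simp add: field_simps)
  then have "expander_rhs N lam z (r z) (p z) > 0"
    by (simp add: expander_rhs_def z(3))
  then obtain d where d: "d > 0" "\<And>h. h > 0 \<Longrightarrow> z + h \<in> {0..b} \<Longrightarrow> h < d \<Longrightarrow> p z < p (z + h)"
    using has_real_derivative_pos_inc_right[OF slope_deriv[OF zb]] by blast
  define h where "h = min (d / 2) (y - z)"
  have h: "h > 0" "h < d" "z + h \<le> y" using d(1) z(2) by (auto simp: h_def min_def field_simps)
  then have "p z < p (z + h)" using d(2)[of h] z(1) y by auto
  moreover have "p (z + h) < 0" using z(4)[of "z + h"] h by auto
  ultimately show False using z(3) by simp
qed

lemma expander_radius_ge:
  assumes y: "y \<in> {0..b}"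
  shows "r y \<ge> \<mu>"
proof -
  have "- r y \<le> - r 0"
  proof (rule half_line_nonincreasing[where f = "\<lambda>x. - r x" and f' = "\<lambda>x. - p x"])
    show "0 \<le> y" using y by simp
    show "((\<lambda>x. - r x) has_real_derivative - p x) (at x within {0..y})" if "x \<in> {0..y}" for x
      by (rule DERIV_minus, rule DERIV_subset[OF radius_deriv]) (use that y in auto)
    show "- p x \<le> 0" if "x \<in> {0<..<y}" for x
      using expander_slope_nonneg[of x] that y by simp
  qed
  then show ?thesis by (simp add: initial_values)
qed

text \<open>Where \<open>p' \<ge> 0\<close> the bounds can be read off from the equation. Where \<open>p' < 0\<close> they are
  inherited from the last earlier zero of \<open>p'\<close>, because from there on \<open>p\<close> decreases and
  \<open>r - y p\<close>, whose derivative is \<open>- y p'\<close>, increases.\<close>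

lemma expander_bounds:
  assumes y: "y \<in> {0..b}"
  shows "1 + (p y)\<^sup>2 \<le> lam * N" "\<mu> / (lam * N) \<le> r y - y * p y"
proof -
  define w where "w x = r x - x * p x" for x
  \<comment> \<open>\<open>A\<close> carries the sign of \<open>p'\<close>, which equals
    \<open>A\<close> times the positive factor \<open>1 + p\<^sup>2\<close>.\<close>
  define A where "A x = N / r x - (1 + (p x)\<^sup>2) / (lam * w x)" for x
  have sq: "1 + (p x)\<^sup>2 > 0" for x using zero_le_power2[of "p x"] by linarith
  have rhs: "expander_rhs N lam x (r x) (p x) = (1 + (p x)\<^sup>2) * A x" for x
    by (simp add: expander_rhs_def A_def w_def)
  have pc: "continuous_on {0..b} p" and rc: "continuous_on {0..b} r"
    using slope_deriv radius_deriv by (meson DERIV_continuous continuous_on_eq_continuous_within)+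
  have wp: "w x > 0" if "x \<in> {0..b}" for x using denominator_pos[OF that] by (simp add: w_def)
  have wc: "continuous_on {0..b} w"
    unfolding w_def by (intro continuous_intros pc rc)
  have Ac: "continuous_on {0..b} A"
    unfolding A_def using radius_pos wp lam by (intro continuous_intros pc rc wc) force+
  \<comment> \<open>Clearing denominators in \<open>A x \<ge> 0\<close> gives
    \<open>(1 + p\<^sup>2) * r \<le> lam * N * w\<close>. Then \<open>w \<le> r\<close> allows
    \<open>r\<close> to be cancelled for the first bound, and \<open>1 \<le> 1 + p\<^sup>2\<close>
    with \<open>\<mu> \<le> r\<close> gives the second.\<close>
  have pointwise: "1 + (p x)\<^sup>2 \<le> lam * N \<and> \<mu> / (lam * N) \<le> w x" if x: "x \<in> {0..b}" and "A x \<ge> 0" for x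
  proof -
    have w: "w x > 0" and rx: "r x > 0" "r x \<ge> \<mu>" and px: "p x \<ge> 0"
      using wp[OF x] radius_pos[OF x] expander_radius_ge[OF x] expander_slope_nonneg[OF x] by auto
    have "w x \<le> r x" using px x by (simp add: w_def)
    have "(1 + (p x)\<^sup>2) / (lam * w x) \<le> N / r x"
      using that by (simp add: A_def)
    then have key: "(1 + (p x)\<^sup>2) * r x \<le> lam * N * w x"
      using w rx lam by (simp add: divide_le_eq field_simps)
    also have "\<dots> \<le> lam * N * r x"
      using \<open>w x \<le> r x\<close> lamN by (intro mult_left_mono) auto
    finally have "1 + (p x)\<^sup>2 \<le> lam * N"
      using rx by (simp add: mult_le_cancel_right)
    moreover have "1 * \<mu> \<le> (1 + (p x)\<^sup>2) * r x"
      using rx \<mu> by (intro mult_mono) auto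
    then have "\<mu> / (lam * N) \<le> w x"
      using key lamN by (simp add: divide_le_eq mult_ac)
    ultimately show ?thesis ..
  qed
  have "1 + (p y)\<^sup>2 \<le> lam * N \<and> \<mu> / (lam * N) \<le> w y"
  proof (cases "A y \<ge> 0")
    case True
    then show ?thesis using pointwise y by blast
  next
    case False
    \<comment> \<open>Positivity of \<open>A\<close> at the start guarantees that a last zero of
      \<open>A\<close> before \<open>y\<close> exists.\<close>
    have "A 0 = (lam * N - 1) / (lam * \<mu>)"
      using lam \<mu> by (simp add: A_def w_def initial_values field_simps)
    then have "A 0 \<ge> 0" using lam lamN \<mu> by simp
    moreover have "continuous_on {0..y} A"
      by (rule continuous_on_subset[OF Ac]) (use y in auto)
    ultimately obtain z where z: "0 \<le> z" "z < y" "A z = 0" "\<And>x. z < x \<Longrightarrow> x \<le> y \<Longrightarrow> A x < 0"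
      using last_nonneg_before[of 0 y A] y False by auto
    have p'_neg: "expander_rhs N lam x (r x) (p x) \<le> 0" if "x \<in> {z<..<y}" for x
      using z(4)[of x] that sq[of x] by (auto simp: rhs intro!: mult_nonneg_nonpos)
    have sub: "{z..y} \<subseteq> {0..b}" using z y by auto
    have "p y \<le> p z"
      by (rule half_line_nonincreasing[where f' = "\<lambda>x. expander_rhs N lam x (r x) (p x)"])
        (use z(2) sub p'_neg in \<open>auto intro: DERIV_subset[OF slope_deriv]\<close>)
    moreover have "- w y \<le> - w z"
    proof (rule half_line_nonincreasing[where f = "\<lambda>x. - w x" and
          f' = "\<lambda>x. x * expander_rhs N lam x (r x) (p x)"])
      show "((\<lambda>x. - w x) has_real_derivative x * expander_rhs N lam x (r x) (p x)) (at x within {z..y})"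
        if "x \<in> {z..y}" for x
        unfolding w_def
        by (rule derivative_eq_intros DERIV_subset[OF radius_deriv[OF subsetD[OF sub that]] sub]
            DERIV_subset[OF slope_deriv[OF subsetD[OF sub that]] sub] refl)+ simp
      show "x * expander_rhs N lam x (r x) (p x) \<le> 0" if "x \<in> {z<..<y}" for x
        using that z(1) p'_neg[OF that] by (intro mult_nonneg_nonpos) auto
    qed (use z(2) in simp)
    moreover have "1 + (p z)\<^sup>2 \<le> lam * N \<and> \<mu> / (lam * N) \<le> w z"
      using pointwise[of z] z sub by auto
    moreover have "0 \<le> p y" by (rule expander_slope_nonneg[OF y])
    \<comment> \<open>Squaring preserves \<open>p y \<le> p z\<close> because
      \<open>0 \<le> p y\<close>.\<close>
    ultimately show ?thesis
      using power_mono[of "p y" "p z" 2] by linarith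
  qed
  then show "1 + (p y)\<^sup>2 \<le> lam * N" "\<mu> / (lam * N) \<le> r y - y * p y"
    by (auto simp: w_def)
qed

end

section \<open>The truncated equation\<close>

text \<open>The slope is cut off to \<open>[-P, P]\<close>, while \<open>r\<close> and
  \<open>r - y * p\<close> are kept at least \<open>c\<close> inside the reciprocals. The
  reciprocals are written as separate factors to fit the product estimates.\<close>

definition clamped_rhs :: "real \<Rightarrow> real \<Rightarrow> real \<Rightarrow> real \<Rightarrow> real \<Rightarrow> real \<Rightarrow> real \<Rightarrow> real" where
  "clamped_rhs N lam P c y r p =
     (1 + (max (- P) (min P p))\<^sup>2) *
       (N * (1 / max c r) - (1 + (max (- P) (min P p))\<^sup>2) * (1 / max c (r - y * p)) / lam)"

lemma clamped_rhs_eq: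
  assumes "\<bar>p\<bar> \<le> P" "c \<le> r" "c \<le> r - y * p"
  shows "clamped_rhs N lam P c y r p = expander_rhs N lam y r p"
proof -
  have "max (- P) (min P p) = p" "max c r = r" "max c (r - y * p) = r - y * p"
    using assms by auto
  then show ?thesis by (simp add: clamped_rhs_def expander_rhs_def mult.commute)
qed

section \<open>Continuity and Lipschitz bounds for the truncated field\<close>

lemma continuous_on_clamped_rhs:
  assumes "c > 0"
  shows "continuous_on S (\<lambda>(t, x). (snd x, clamped_rhs N lam P c t (fst x) (snd x)))"
proof -
  have "max c u \<noteq> 0" for u :: real using assms by linarith
  then show ?thesis
    unfolding clamped_rhs_def case_prod_beta' divide_inverse
    by (intro continuous_intros) auto
qed

text \<open>Product rule for Lipschitz estimates: \<open>A\<close> and \<open>B\<close> are sup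
  bounds, \<open>\<alpha>\<close> and \<open>\<beta>\<close> are Lipschitz constants relative to a
  common error \<open>e\<close>.\<close>

lemma product_difference_bound:
  fixes a a' b b' :: real
  assumes "\<bar>a\<bar> \<le> A" "\<bar>b'\<bar> \<le> B" "\<bar>a - a'\<bar> \<le> \<alpha> * e" "\<bar>b - b'\<bar> \<le> \<beta> * e"
  shows "\<bar>a * b - a' * b'\<bar> \<le> (A * \<beta> + B * \<alpha>) * e"
proof -
  have "a * b - a' * b' = a * (b - b') + b' * (a - a')" by (simp add: algebra_simps)
  then have "\<bar>a * b - a' * b'\<bar> \<le> \<bar>a\<bar> * \<bar>b - b'\<bar> + \<bar>b'\<bar> * \<bar>a - a'\<bar>"
    by (metis abs_mult abs_triangle_ineq)
  also have "\<dots> \<le> A * (\<beta> * e) + B * (\<alpha> * e)"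
    using assms by (intro add_mono mult_mono) auto
  finally show ?thesis by (simp add: algebra_simps)
qed

lemma inverse_max_bound:
  fixes c u v :: real
  assumes "c > 0"
  shows "\<bar>1 / max c u\<bar> \<le> 1 / c" "\<bar>1 / max c u - 1 / max c v\<bar> \<le> 1 / c\<^sup>2 * \<bar>u - v\<bar>"
proof -
  have pos: "max c u > 0" "max c v > 0" and ge: "c \<le> max c u" "c \<le> max c v"
    using assms by auto
  show "\<bar>1 / max c u\<bar> \<le> 1 / c"
    using assms pos ge by (simp add: frac_le)
  have "\<bar>1 / max c u - 1 / max c v\<bar> = \<bar>max c v - max c u\<bar> / (max c u * max c v)"
    using pos by (simp add: diff_frac_eq abs_mult)
  also have "\<dots> \<le> \<bar>u - v\<bar> / (c * c)"
    using assms pos ge by (intro frac_le mult_mono) auto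
  finally show "\<bar>1 / max c u - 1 / max c v\<bar> \<le> 1 / c\<^sup>2 * \<bar>u - v\<bar>"
    by (simp add: power2_eq_square)
qed

text \<open>After truncation every factor is bounded and Lipschitz, so the product estimate applies
  twice. The factor \<open>1 + t\<close> comes from \<open>r - t * p\<close>, which depends on
  \<open>p\<close> with weight \<open>t\<close>.\<close>

lemma clamped_rhs_lipschitz:
  assumes "c > 0" "P \<ge> 0"
  obtains C where "C \<ge> 0"
    and "\<And>t r p r' p'. t \<ge> 0 \<Longrightarrow>
      \<bar>clamped_rhs N lam P c t r p - clamped_rhs N lam P c t r' p'\<bar>
        \<le> C * ((1 + t) * (\<bar>r - r'\<bar> + \<bar>p - p'\<bar>))"
proof -
  \<comment> \<open>\<open>Q\<close> bounds the factor \<open>1 + p\<^sup>2\<close> after clamping,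
    whose Lipschitz constant is \<open>2 * P\<close>; \<open>B\<close> bounds the bracket and
    \<open>\<beta>\<close> is its Lipschitz constant.\<close>
  define Q where "Q = 1 + P\<^sup>2"
  define B where "B = \<bar>N\<bar> * (1 / c) + Q * (1 / c) / \<bar>lam\<bar>"
  define \<beta> where "\<beta> = \<bar>N\<bar> * (1 / c\<^sup>2) + (Q * (1 / c\<^sup>2) + 1 / c * (2 * P)) / \<bar>lam\<bar>"
  define C where "C = Q * \<beta> + B * (2 * P)"
  have Q: "Q \<ge> 0" by (simp add: Q_def)
  have "C \<ge> 0" using assms Q by (simp add: C_def B_def \<beta>_def)
  moreover have "\<bar>clamped_rhs N lam P c t r p - clamped_rhs N lam P c t r' p'\<bar>
        \<le> C * ((1 + t) * (\<bar>r - r'\<bar> + \<bar>p - p'\<bar>))" if t: "t \<ge> 0" for t r p r' p'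
  proof -
    \<comment> \<open>This single error dominates the changes of \<open>r\<close>, of
      \<open>p\<close> and of \<open>r - t * p\<close> simultaneously.\<close>
    define e where "e = (1 + t) * (\<bar>r - r'\<bar> + \<bar>p - p'\<bar>)"
    define q where "q x = max (- P) (min P x)" for x
    define u where "u x = 1 / max c x" for x
    have eq: "e = \<bar>r - r'\<bar> + \<bar>p - p'\<bar> + t * \<bar>r - r'\<bar> + t * \<bar>p - p'\<bar>"
      by (simp add: e_def algebra_simps)
    have t': "0 \<le> t * \<bar>r - r'\<bar>" "0 \<le> t * \<bar>p - p'\<bar>" using t by auto
    have e0: "e \<ge> 0" using t by (simp add: e_def)
    have q: "\<bar>q x\<bar> \<le> P" for x using assms by (auto simp: q_def)
    have Qb: "\<bar>1 + (q x)\<^sup>2\<bar> \<le> Q" for x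
      using power_mono[OF q[of x] abs_ge_zero, of 2] by (simp add: Q_def)
    have "\<bar>q p - q p'\<bar> \<le> \<bar>p - p'\<bar>" unfolding q_def by linarith
    then have qe: "\<bar>q p - q p'\<bar> \<le> e" unfolding eq using t' by linarith
    have "\<bar>(1 + (q p)\<^sup>2) - (1 + (q p')\<^sup>2)\<bar> = \<bar>q p + q p'\<bar> * \<bar>q p - q p'\<bar>"
      by (simp add: abs_mult[symmetric] power2_eq_square algebra_simps)
    also have "\<dots> \<le> 2 * P * e"
      using q[of p] q[of p'] qe assms by (intro mult_mono) auto
    finally have Qe: "\<bar>(1 + (q p)\<^sup>2) - (1 + (q p')\<^sup>2)\<bar> \<le> 2 * P * e" .
    have u: "\<bar>u x\<bar> \<le> 1 / c" for x
      unfolding u_def by (rule inverse_max_bound(1)[OF assms(1)])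
    have ue: "\<bar>u x - u x'\<bar> \<le> 1 / c\<^sup>2 * e" if "\<bar>x - x'\<bar> \<le> e" for x x'
      unfolding u_def using inverse_max_bound(2)[OF assms(1), of x x'] mult_left_mono[OF that, of "1 / c\<^sup>2"] by simp
    have ur: "\<bar>u r - u r'\<bar> \<le> 1 / c\<^sup>2 * e"
      by (rule ue) (use t' in \<open>simp add: eq\<close>)
    have "\<bar>(r - t * p) - (r' - t * p')\<bar> = \<bar>(r - r') - t * (p - p')\<bar>"
      by (simp add: algebra_simps)
    also have "\<dots> \<le> \<bar>r - r'\<bar> + t * \<bar>p - p'\<bar>"
      using abs_triangle_ineq4[of "r - r'" "t * (p - p')"] t by (simp add: abs_mult)
    finally have uw: "\<bar>u (r - t * p) - u (r' - t * p')\<bar> \<le> 1 / c\<^sup>2 * e"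
      by (intro ue) (use t' in \<open>unfold eq, linarith\<close>)
    have prod: "\<bar>(1 + (q p)\<^sup>2) * u (r - t * p) - (1 + (q p')\<^sup>2) * u (r' - t * p')\<bar>
        \<le> (Q * (1 / c\<^sup>2) + 1 / c * (2 * P)) * e"
      by (rule product_difference_bound[OF Qb u Qe uw])
    define G where "G r p = N * u r - (1 + (q p)\<^sup>2) * u (r - t * p) / lam" for r p
    have "\<bar>G r' p'\<bar> \<le> \<bar>N\<bar> * \<bar>u r'\<bar> + \<bar>1 + (q p')\<^sup>2\<bar> * \<bar>u (r' - t * p')\<bar> / \<bar>lam\<bar>"
      unfolding G_def by (rule order_trans[OF abs_triangle_ineq4]) (simp add: abs_mult)
    also have "\<dots> \<le> B"
      unfolding B_def using Q by (intro add_mono mult_mono divide_right_mono Qb u) auto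
    finally have GB: "\<bar>G r' p'\<bar> \<le> B" .
    have "G r p - G r' p' = N * (u r - u r')
        - ((1 + (q p)\<^sup>2) * u (r - t * p) - (1 + (q p')\<^sup>2) * u (r' - t * p')) / lam"
      unfolding G_def by (simp add: algebra_simps diff_divide_distrib add_divide_distrib)
    then have "\<bar>G r p - G r' p'\<bar> \<le> \<bar>N\<bar> * \<bar>u r - u r'\<bar>
        + \<bar>(1 + (q p)\<^sup>2) * u (r - t * p) - (1 + (q p')\<^sup>2) * u (r' - t * p')\<bar> / \<bar>lam\<bar>"
      using abs_triangle_ineq4 by (metis abs_divide abs_mult)
    also have "\<dots> \<le> \<bar>N\<bar> * (1 / c\<^sup>2 * e) + (Q * (1 / c\<^sup>2) + 1 / c * (2 * P)) * e / \<bar>lam\<bar>"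
      by (intro add_mono mult_left_mono divide_right_mono prod ur) auto
    also have "\<dots> = \<beta> * e" by (simp add: \<beta>_def algebra_simps)
    finally have Ge: "\<bar>G r p - G r' p'\<bar> \<le> \<beta> * e" .
    have "\<bar>(1 + (q p)\<^sup>2) * G r p - (1 + (q p')\<^sup>2) * G r' p'\<bar> \<le> C * e"
      unfolding C_def by (rule product_difference_bound[OF Qb GB Qe Ge])
    then show ?thesis
      by (simp add: clamped_rhs_def G_def u_def q_def e_def)
  qed
  ultimately show ?thesis by (rule that)
qed

lemma clamped_field_lipschitz:
  assumes "c > 0" "P \<ge> 0"
  obtains l :: "real \<Rightarrow> real" where "continuous_on {0..} l"
    and "\<And>t x y. t \<ge> 0 \<Longrightarrow>
      norm ((snd x, clamped_rhs N lam P c t (fst x) (snd x)) -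
            (snd y, clamped_rhs N lam P c t (fst y) (snd y))) \<le> l t * norm (x - y)"
proof -
  obtain C where C: "C \<ge> 0" "\<And>t r p r' p'. t \<ge> 0 \<Longrightarrow>
      \<bar>clamped_rhs N lam P c t r p - clamped_rhs N lam P c t r' p'\<bar>
        \<le> C * ((1 + t) * (\<bar>r - r'\<bar> + \<bar>p - p'\<bar>))"
    using clamped_rhs_lipschitz[OF assms] by blast
  \<comment> \<open>The summand 1 accounts for the component \<open>snd x\<close>; the 2 arises
    because each of the two coordinate differences is bounded by the norm.\<close>
  define l where "l t = 1 + 2 * C * (1 + t)" for t
  have "continuous_on {0..} l" unfolding l_def by (intro continuous_intros)
  moreover have "norm ((snd x, clamped_rhs N lam P c t (fst x) (snd x)) -
            (snd y, clamped_rhs N lam P c t (fst y) (snd y))) \<le> l t * norm (x - y)"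
    if t: "t \<ge> 0" for t and x y :: "real \<times> real"
  proof -
    have d: "\<bar>fst x - fst y\<bar> \<le> norm (x - y)" "\<bar>snd x - snd y\<bar> \<le> norm (x - y)"
      using norm_fst_le[of "fst (x - y)" "snd (x - y)"] norm_snd_le[of "snd (x - y)" "fst (x - y)"]
      by (simp_all add: minus_prod_def)
    have "norm ((snd x, clamped_rhs N lam P c t (fst x) (snd x)) -
            (snd y, clamped_rhs N lam P c t (fst y) (snd y)))
        \<le> \<bar>snd x - snd y\<bar> + \<bar>clamped_rhs N lam P c t (fst x) (snd x) - clamped_rhs N lam P c t (fst y) (snd y)\<bar>"
      unfolding diff_Pair by (metis norm_Pair_le real_norm_def)
    also have "\<dots> \<le> norm (x - y) + C * ((1 + t) * (norm (x - y) + norm (x - y)))"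
      using C t d by (intro add_mono order_trans[OF C(2)[OF t]] mult_left_mono) auto
    also have "\<dots> = l t * norm (x - y)" by (simp add: l_def algebra_simps)
    finally show ?thesis .
  qed
  ultimately show ?thesis by (rule that)
qed

section \<open>Global existence and uniqueness\<close>

text \<open>Half of the a priori lower bound for \<open>r - y * p\<close>, so that true solutions
  stay strictly away from the truncation.\<close>

definition expander_threshold :: "real \<Rightarrow> real \<Rightarrow> real \<Rightarrow> real" where
  "expander_threshold N lam \<mu> = \<mu> / (lam * N) / 2"

definition clamped_field :: "real \<Rightarrow> real \<Rightarrow> real \<Rightarrow> real \<Rightarrow> real \<times> real \<Rightarrow> real \<times> real" where
  "clamped_field N lam \<mu> t x =
     (snd x, clamped_rhs N lam (lam * N) (expander_threshold N lam \<mu>) t (fst x) (snd x))"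

text \<open>Since \<open>2 * \<bar>q\<bar> \<le> 1 + q\<^sup>2\<close>, the a priori bound on
  \<open>1 + p\<^sup>2\<close> keeps the slope strictly below the cutoff \<open>lam * N\<close>,
  with no square root involved.\<close>

lemma abs_less_of_square:
  fixes q K :: real
  assumes "1 + q\<^sup>2 \<le> K"
  shows "\<bar>q\<bar> < K"
proof -
  have "0 \<le> (\<bar>q\<bar> - 1)\<^sup>2" by simp
  then have "2 * \<bar>q\<bar> \<le> 1 + q\<^sup>2" by (simp add: power2_diff)
  moreover have "0 < 1 + q\<^sup>2" using zero_le_power2[of q] by linarith
  ultimately show ?thesis using assms by linarith
qed

section \<open>Existence and uniqueness for the first-order system\<close>

context
  fixes N lam \<mu> :: real
  assumes N: "N > 0" and lam: "lam > 0" and lamN: "lam * N > 1" and \<mu>: "\<mu> > 0"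
begin

lemmas expander_a_priori = expander_radius_ge[OF N lam lamN \<mu>] expander_bounds[OF N lam lamN \<mu>]

lemma threshold_bounds:
  "0 < expander_threshold N lam \<mu>"
  "expander_threshold N lam \<mu> < \<mu> / (lam * N)"
  "expander_threshold N lam \<mu> < \<mu>"
proof -
  define m where "m = \<mu> / (lam * N)"
  have m: "0 < m" "expander_threshold N lam \<mu> = m / 2"
    using \<mu> lamN by (simp_all add: m_def expander_threshold_def)
  then show "0 < expander_threshold N lam \<mu>" "expander_threshold N lam \<mu> < \<mu> / (lam * N)"
    unfolding m_def[symmetric] by simp_all
  have "\<mu> / (lam * N) < \<mu> / 1"
    using \<mu> lamN by (intro divide_strict_left_mono) auto
  then show "expander_threshold N lam \<mu> < \<mu>" using m unfolding m_def[symmetric] by simp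
qed

lemma clamped_field_lip:
  obtains l :: "real \<Rightarrow> real" where "continuous_on {0..} l"
    and "\<And>t x y. t \<ge> 0 \<Longrightarrow> norm (clamped_field N lam \<mu> t x - clamped_field N lam \<mu> t y) \<le> l t * norm (x - y)"
proof (rule clamped_field_lipschitz[OF threshold_bounds(1), of "lam * N" N lam])
  show "0 \<le> lam * N" using lamN by simp
qed (rule that, auto simp: clamped_field_def)

text \<open>Continuity argument: the truncated system has a global solution, which solves the
  original one up to any first time the truncation is reached. The a priori bounds hold before that
  time, pass to the limit, and are stricter than the truncation, so there is no such time.\<close>

lemma expander_exists:
  obtains r p where "solves_expander N lam \<mu> r p {0..}"
proof -
  obtain l where l: "continuous_on {0..} l"
    "\<And>t x y. t \<ge> 0 \<Longrightarrow> norm (clamped_field N lam \<mu> t x - clamped_field N lam \<mu> t y) \<le> l t * norm (x - y)"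
    using clamped_field_lip by blast
  have "continuous_on ({0..} \<times> UNIV) (\<lambda>(t, x). clamped_field N lam \<mu> t x)"
    unfolding clamped_field_def by (rule continuous_on_clamped_rhs[OF threshold_bounds(1)])
  then obtain X where X0: "X 0 = (\<mu>, 0)" and
    X: "\<And>t. t \<ge> 0 \<Longrightarrow> (X has_vector_derivative clamped_field N lam \<mu> t (X t)) (at t within {0..})"
    using ode_exists_half_line[OF _ l, of "(\<mu>, 0)"] by blast
  define r p where "r t = fst (X t)" and "p t = snd (X t)" for t
  define w where "w t = r t - t * p t" for t
  define R where "R t = clamped_rhs N lam (lam * N) (expander_threshold N lam \<mu>) t (r t) (p t)" for t
  have init: "r 0 = \<mu>" "p 0 = 0" by (simp_all add: r_def p_def X0)
  have r: "(r has_real_derivative p t) (at t within {0..})" if "t \<ge> 0" for t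
    using bounded_linear.has_vector_derivative[OF bounded_linear_fst X[OF that]]
    by (simp add: has_real_derivative_iff_has_vector_derivative r_def[abs_def] p_def clamped_field_def)
  have p: "(p has_real_derivative R t) (at t within {0..})" if "t \<ge> 0" for t
    using bounded_linear.has_vector_derivative[OF bounded_linear_snd X[OF that]]
    by (simp add: has_real_derivative_iff_has_vector_derivative r_def p_def[abs_def] clamped_field_def R_def)
  have rc: "continuous_on {0..} r" and pc: "continuous_on {0..} p"
    using r p by (meson DERIV_continuous atLeast_iff continuous_on_eq_continuous_within)+
  have wc: "continuous_on {0..} w"
    unfolding w_def by (intro continuous_intros rc pc)
  \<comment> \<open>The inequalities are strict so that the set of bad times is closed and has a
    first element; at good times the truncation is inactive.\<close>
  define good where "good t \<longleftrightarrow> expander_threshold N lam \<mu> < r t \<and> \<bar>p t\<bar> < lam * N \<and> expander_threshold N lam \<mu> < w t" for t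
  have R_eq: "R t = expander_rhs N lam t (r t) (p t)" if "good t" for t
    using that unfolding R_def good_def w_def by (intro clamped_rhs_eq) auto
  have pos: "r t > 0" "r t - t * p t > 0" if "good t" for t
    using that threshold_bounds(1) by (auto simp: good_def w_def)
  have good: "good t" if t: "t \<ge> 0" for t
  proof (rule ccontr)
    assume "\<not> good t"
    define bad where "bad = {x \<in> {0..}. r x \<le> expander_threshold N lam \<mu>} \<union> {x \<in> {0..}. lam * N \<le> \<bar>p x\<bar>}
      \<union> {x \<in> {0..}. w x \<le> expander_threshold N lam \<mu>}"
    have bad: "x \<in> bad \<longleftrightarrow> 0 \<le> x \<and> \<not> good x" for x
      by (auto simp: bad_def good_def)
    have "closed bad"
      unfolding bad_def
      by (intro closed_Un continuous_on_closed_Collect_le continuous_intros rc pc wc closed_atLeast)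
    moreover have ne: "bad \<noteq> {}" using t \<open>\<not> good t\<close> bad by blast
    moreover have bdd: "bdd_below bad" by (rule bdd_belowI[of _ 0]) (simp add: bad)
    ultimately have "Inf bad \<in> bad" by (intro closed_contains_Inf)
    define z where "z = Inf bad"
    have z: "z \<ge> 0" "\<not> good z" using \<open>Inf bad \<in> bad\<close> by (auto simp: z_def bad)
    have before: "good x" if "0 \<le> x" "x < z" for x
      using cInf_lower[OF _ bdd, of x] that by (force simp: bad z_def)
    have "good 0" using lamN \<mu> threshold_bounds by (simp add: good_def init w_def)
    then have "z > 0" using z by (cases "z = 0") auto
    \<comment> \<open>The a priori bounds are non-strict and define a closed set; containing
      \<open>{0..<z}\<close>, it also contains the first bad time \<open>z\<close>.\<close>
    define S where "S = {x \<in> {0..}. \<mu> \<le> r x} \<inter> {x \<in> {0..}. 1 + (p x)\<^sup>2 \<le> lam * N}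
      \<inter> {x \<in> {0..}. \<mu> / (lam * N) \<le> w x}"
    have "closed S" unfolding S_def
      by (intro closed_Int continuous_on_closed_Collect_le continuous_intros rc pc wc closed_atLeast)
    moreover have "{0..<z} \<subseteq> S"
    proof
      fix x assume x: "x \<in> {0..<z}"
      have "solves_expander N lam \<mu> r p {0..x}"
        unfolding solves_expander_def
      proof (intro conjI ballI init)
        fix v assume v: "v \<in> {0..x}"
        then have "good v" using x by (intro before) auto
        then show "r v > 0" "r v - v * p v > 0" by (rule pos)+
        show "(r has_real_derivative p v) (at v within {0..x})"
          by (rule DERIV_subset[OF r]) (use v in auto)
        show "(p has_real_derivative expander_rhs N lam v (r v) (p v)) (at v within {0..x})"
          unfolding R_eq[OF \<open>good v\<close>, symmetric] by (rule DERIV_subset[OF p]) (use v in auto)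
      qed
      from expander_a_priori[OF this, of x] x show "x \<in> S"
        by (auto simp: S_def w_def)
    qed
    ultimately have "closure {0..<z} \<subseteq> S" by (intro closure_minimal)
    then have "z \<in> S" using \<open>z > 0\<close> by auto
    then have "good z"
      using threshold_bounds by (auto simp: S_def good_def intro: abs_less_of_square)
    with z(2) show False ..
  qed
  show ?thesis
    by (rule that[of r p]) (use r p R_eq good pos init in \<open>simp add: solves_expander_def\<close>)
qed

text \<open>By the a priori bounds every solution also solves the truncated system, where the
  Lipschitz uniqueness result applies.\<close>

lemma expander_unique:
  assumes "solves_expander N lam \<mu> r p {0..}" "solves_expander N lam \<mu> s q {0..}" "y \<ge> 0"
  shows "r y = s y"
proof -
  have field: "((\<lambda>t. (r t, p t)) has_vector_derivative clamped_field N lam \<mu> t (r t, p t)) (at t within {0..})"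
    if sol: "solves_expander N lam \<mu> r p {0..}" and t: "t \<ge> 0" for r p t
  proof -
    have "solves_expander N lam \<mu> r p {0..t}" by (rule solves_expander_subset[OF sol]) auto
    from expander_a_priori[OF this, of t] t
    have "clamped_field N lam \<mu> t (r t, p t) = (p t, expander_rhs N lam t (r t) (p t))"
      using threshold_bounds unfolding clamped_field_def by (auto intro!: clamped_rhs_eq less_imp_le[OF abs_less_of_square])
    moreover have "(r has_vector_derivative p t) (at t within {0..})"
      "(p has_vector_derivative expander_rhs N lam t (r t) (p t)) (at t within {0..})"
      using sol t
      by (auto simp: solves_expander_def has_real_derivative_iff_has_vector_derivative[symmetric])
    ultimately show ?thesis
      by (auto intro!: has_vector_derivative_Pair)
  qed
  obtain l where l: "continuous_on {0..} l"
    "\<And>t x y. t \<ge> 0 \<Longrightarrow> norm (clamped_field N lam \<mu> t x - clamped_field N lam \<mu> t y) \<le> l t * norm (x - y)"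
    using clamped_field_lip by blast
  have "(r y, p y) = (s y, q y)"
    by (rule ode_unique_half_line[OF l field[OF assms(1)] field[OF assms(2)] _ assms(3)])
      (use assms(1,2) in \<open>auto simp: solves_expander_def\<close>)
  then show ?thesis by simp
qed

end

section \<open>Translation to one-sided derivatives\<close>

lemma half_deriv_eq:
  assumes "(f has_real_derivative d) (at y within {0..})" "y \<ge> 0"
  shows "half_deriv f y = d"
  using assms unfolding half_deriv_def has_real_derivative_iff_has_vector_derivative
  by (intro vector_derivative_within half_line_not_bot)

lemma half_deriv_works:
  assumes "f differentiable_on {0..}" "y \<ge> 0"
  shows "(f has_real_derivative half_deriv f y) (at y within {0..})"
  using assms unfolding half_deriv_def has_real_derivative_iff_has_vector_derivative
  by (simp add: differentiable_on_def vector_derivative_works)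

lemma expander_rhs_eq_iff:
  "z / (1 + p\<^sup>2) = N / r - (1 + p\<^sup>2) / (lam * (r - y * p)) \<longleftrightarrow> z = expander_rhs N lam y r p"
proof -
  have "1 + p\<^sup>2 \<noteq> 0" using zero_le_power2[of p] by linarith
  then show ?thesis unfolding expander_rhs_def by (simp add: divide_eq_eq mult.commute)
qed

lemma solves_expander_is_solution:
  assumes "solves_expander (real n - 1) lam \<mu> r p {0..}" "lam > 0"
  shows "is_solution n lam \<mu> r"
    and "\<And>y. y \<ge> 0 \<Longrightarrow> half_deriv r y = p y"
    and "\<And>y. y \<ge> 0 \<Longrightarrow> half_deriv (half_deriv r) y = expander_rhs (real n - 1) lam y (r y) (p y)"
proof -
  let ?R = "\<lambda>y. expander_rhs (real n - 1) lam y (r y) (p y)"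
  have sol: "r 0 = \<mu>" "p 0 = 0"
    "\<And>y. y \<ge> 0 \<Longrightarrow> (r has_real_derivative p y) (at y within {0..})"
    "\<And>y. y \<ge> 0 \<Longrightarrow> (p has_real_derivative ?R y) (at y within {0..})"
    "\<And>y. y \<ge> 0 \<Longrightarrow> r y > 0" "\<And>y. y \<ge> 0 \<Longrightarrow> r y - y * p y > 0"
    using assms(1) unfolding solves_expander_def by auto
  show h1: "half_deriv r y = p y" if "y \<ge> 0" for y
    by (rule half_deriv_eq[OF sol(3) that]) fact
  have d2: "(half_deriv r has_real_derivative ?R y) (at y within {0..})" if "y \<ge> 0" for y
    using that h1 by (intro has_field_derivative_transform_within[OF sol(4)[OF that] zero_less_one]) auto
  show h2: "half_deriv (half_deriv r) y = ?R y" if "y \<ge> 0" for y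
    by (rule half_deriv_eq[OF d2 that]) fact
  have rc: "continuous_on {0..} r" and pc: "continuous_on {0..} p"
    using sol(3,4) by (meson DERIV_continuous atLeast_iff continuous_on_eq_continuous_within)+
  have "continuous_on {0..} ?R"
    unfolding expander_rhs_def using sol(5,6) assms(2)
    by (intro continuous_intros rc pc) force+
  then have "continuous_on {0..} (half_deriv (half_deriv r))"
    by (rule continuous_on_eq) (simp add: h2)
  moreover have "r differentiable_on {0..}" "half_deriv r differentiable_on {0..}"
    using sol(3) d2 unfolding differentiable_on_def
    by (meson atLeast_iff has_field_derivative_def differentiableI)+
  ultimately show "is_solution n lam \<mu> r"
    unfolding is_solution_def C2_half_line_def expander_rhs_eq_iff
    using sol(1,2) sol(6)[OF less_imp_le] by (fastforce simp: h1 h2 sol(5))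
qed

text \<open>Two facts are recovered by continuity: the denominator is positive rather than merely
  nonzero, and the equation extends to \<open>y = 0\<close>.\<close>

lemma is_solution_solves_expander:
  assumes "\<mu> > 0" "lam > 0" "is_solution n lam \<mu> s"
  shows "solves_expander (real n - 1) lam \<mu> s (half_deriv s) {0..}"
proof -
  let ?R = "\<lambda>y. expander_rhs (real n - 1) lam y (s y) (half_deriv s y)"
  define w where "w y = s y - y * half_deriv s y" for y
  have diff: "s differentiable_on {0..}" "half_deriv s differentiable_on {0..}"
    and cont: "continuous_on {0..} (half_deriv (half_deriv s))"
    and init: "s 0 = \<mu>" "half_deriv s 0 = 0"
    and eq: "\<And>y. y > 0 \<Longrightarrow> half_deriv (half_deriv s) y = ?R y"
    and "\<And>y. y > 0 \<Longrightarrow> w y \<noteq> 0" "\<And>y. y > 0 \<Longrightarrow> s y > 0"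
    using assms(3) unfolding is_solution_def C2_half_line_def w_def
    by (auto simp: expander_rhs_eq_iff)
  then have w: "w y \<noteq> 0" and s: "s y > 0" if "y \<ge> 0" for y
    using that assms(1) by (cases "y = 0"; simp add: w_def)+
  have sc: "continuous_on {0..} s" and pc: "continuous_on {0..} (half_deriv s)"
    using diff by (auto intro: differentiable_imp_continuous_on)
  have wc: "continuous_on {0..} w"
    unfolding w_def by (intro continuous_intros sc pc)
  \<comment> \<open>The denominator starts at \<open>\<mu> > 0\<close> and never vanishes, so by the
    intermediate value theorem it cannot change sign.\<close>
  have wpos: "w y > 0" if "y \<ge> 0" for y
  proof (rule ccontr)
    assume "\<not> w y > 0"
    moreover have "w 0 = \<mu>" by (simp add: w_def init)
    ultimately have "\<exists>x\<ge>0. x \<le> y \<and> w x = 0"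
      using that assms(1) by (intro IVT2') (auto intro: continuous_on_subset[OF wc])
    then show False using w by blast
  qed
  have Rc: "continuous_on {0..} ?R"
    unfolding expander_rhs_def w_def[symmetric] using s w assms(2)
    by (intro continuous_intros sc pc wc) force+
  \<comment> \<open>The equation is given for \<open>y > 0\<close> only; both sides are continuous
    on \<open>{0..}\<close>, the closure of \<open>{0<..}\<close>.\<close>
  have "half_deriv (half_deriv s) y - ?R y = 0" if "y \<ge> 0" for y
    by (rule continuous_constant_on_closure[where S = "{0<..}"])
      (use that eq in \<open>auto intro!: continuous_on_diff cont Rc\<close>)
  then have "(half_deriv s has_real_derivative ?R y) (at y within {0..})" if "y \<ge> 0" for y
    using half_deriv_works[OF diff(2) that] that by simp
  then show ?thesis
    unfolding solves_expander_def
    using init s wpos half_deriv_works[OF diff(1)] by (simp add: w_def)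
qed

theorem theorem1p3:
  fixes n :: nat and lam \<mu> :: real
  assumes "n \<ge> 2" and "lam > 1 / (real n - 1)" and "\<mu> > 0"
  shows "\<exists>r. is_solution n lam \<mu> r \<and>
             (\<forall>s. is_solution n lam \<mu> s \<longrightarrow> (\<forall>y\<ge>0. s y = r y)) \<and>
             (\<forall>y>0. r y > y * half_deriv r y) \<and>
             half_deriv (half_deriv r) 0 = (real n - 1 - 1 / lam) * (1 / \<mu>)"
proof -
  define N where "N = real n - 1"
  have N: "N > 0" using assms(1) by (simp add: N_def)
  then have "1 / N > 0" by simp
  then have lam: "lam > 0" using assms(2) unfolding N_def by linarith
  have lamN: "lam * N > 1" using assms(2) N by (simp add: N_def[symmetric] divide_less_eq)
  obtain r p where sol: "solves_expander N lam \<mu> r p {0..}"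
    using expander_exists[OF N lam lamN assms(3)] by blast
  note r = solves_expander_is_solution[OF sol[unfolded N_def] lam]
  \<comment> \<open>The prescribed second derivative at 0 is the equation itself evaluated at the
    initial data.\<close>
  have "half_deriv (half_deriv r) 0 = expander_rhs N lam 0 \<mu> 0"
    using r(3)[of 0] sol unfolding solves_expander_def N_def by simp
  then have "half_deriv (half_deriv r) 0 = (real n - 1 - 1 / lam) * (1 / \<mu>)"
    by (simp add: expander_rhs_def N_def diff_divide_distrib)
  moreover have "s y = r y" if "is_solution n lam \<mu> s" "y \<ge> 0" for s y
    by (rule expander_unique[OF N lam lamN assms(3)
          is_solution_solves_expander[OF assms(3) lam that(1), folded N_def] sol that(2)])
  moreover have "r y > y * half_deriv r y" if "y > 0" for y
    using sol r(2)[of y] that by (simp add: solves_expander_def)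
  ultimately show ?thesis using r(1) by (intro exI[of _ r] conjI allI impI)
qed

end
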